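(* For a positive integer $N$ let $$f(N):=\max\{|A|: A\subseteq[N]^2,\ A\text{ contains no isosceles triangle}\}.$$ There is an absolute constant $c>0$ such that, for all $N\ge3$, $$f(N)\ll N^2\exp\left(-c\,\frac{\log N}{\log\log N}\right).$$
   Context: $[N]^2=\{1,\ldots,N\}\times\{1,\ldots,N\}$. Isosceles triangles are allowed to be degenerate: an isosceles triangle in $A$ is a triple of distinct points $a,b,c\in A$ with $|a-b|=|a-c|$ (Euclidean distance), so three equally spaced collinear points count as an isosceles triangle. $X\ll Y$ means $X\le CY$ for an absolute constant $C>0$. *)

theory Defs
  imports "HOL-Analysis.Analysis"
begin

(* The points live in real \<times> real because the library metric dist there is the
   Euclidean one (dist_prod_def). *)
definition grid :: "nat \<Rightarrow> (real \<times> real) set" where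
  "grid N = real ` {1..N} \<times> real ` {1..N}"

(* a is the apex. Non-collinearity is not required, so degenerate triangles
   (three equally spaced collinear points) count. *)
definition isosceles_triangle :: "'a::metric_space \<Rightarrow> 'a \<Rightarrow> 'a \<Rightarrow> bool" where
  "isosceles_triangle a b c \<longleftrightarrow>
     a \<noteq> b \<and> a \<noteq> c \<and> b \<noteq> c \<and> dist a b = dist a c"

definition isosceles_free :: "'a::metric_space set \<Rightarrow> bool" where
  "isosceles_free A \<longleftrightarrow> \<not> (\<exists>a\<in>A. \<exists>b\<in>A. \<exists>c\<in>A. isosceles_triangle a b c)"

definition max_isosceles_free :: "nat \<Rightarrow> nat" where
  "max_isosceles_free N = Max {card A | A. A \<subseteq> grid N \<and> isosceles_free A}"

(* The maximum is taken over a finite nonempty set, so Max is meaningful. *)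
lemma max_isosceles_free_wf:
  shows "finite {card A | A. A \<subseteq> grid N \<and> isosceles_free A}"
    and "{card A | A. A \<subseteq> grid N \<and> isosceles_free A} \<noteq> {}"
proof -
  have "finite (Pow (grid N))"
    by (simp add: grid_def)
  then have "finite (card ` Pow (grid N))"
    by (rule finite_imageI)
  then show "finite {card A | A. A \<subseteq> grid N \<and> isosceles_free A}"
    by (rule rev_finite_subset) auto
  have "isosceles_free ({} :: (real \<times> real) set)"
    by (simp add: isosceles_free_def)
  then show "{card A | A. A \<subseteq> grid N \<and> isosceles_free A} \<noteq> {}"
    by blast
qed

end

theory Submission
  imports Defs "HOL-Number_Theory.Cong" "HOL-Library.Discrete_Functions"
begin

text \<open>Let \<open>S\<close> be a set of \<open>K\<close> lattice vectors of the same length \<open>sqrt n\<close>. If \<open>A\<close> contains no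
isosceles triangle, then for every point \<open>a\<close> of \<open>A\<close> and every \<open>m \<noteq> 0\<close> at most one of the
points \<open>a + m s\<close>, \<open>s \<in> S\<close>, lies in \<open>A\<close>, as two of them would be equidistant from \<open>a\<close>. On the
other hand, if \<open>A\<close> is dense, then an average progression of \<open>M\<close> terms in any fixed direction
\<open>s\<close> contains many points of \<open>A\<close>, hence many pairs \<open>a, a + m s\<close>. Adding this up over the
\<open>K\<close> directions (\<open>card_le_of_unique_progression_direction\<close>, a Cauchy--Schwarz argument)
shows that the density of \<open>A\<close> is \<open>O(1 / K + 1 / M)\<close>. A single step, \<open>m = 1\<close>, would not do:
the points with odd coordinate sum, for instance, have no two at a distance \<open>sqrt n\<close> with \<open>n\<close> odd.

The progressions have to fit into the grid, that is \<open>M * sqrt n \<le> N\<close>, so \<open>n\<close> and \<open>M\<^sup>2\<close> are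
allowed to be as large as \<open>N\<close>. It remains to find a circle with
\<open>K \<ge> exp (c log N / log log N)\<close> lattice points and \<open>n \<le> N\<close>. A product of \<open>k\<close> distinct odd primes
that are sums of two squares has at least \<open>2 ^ k\<close> representations as such a sum
(\<open>card_circle_points_prod_primes\<close>), so it suffices to have \<open>k \<ge> c log N / log log N\<close> such primes
of size at most a power of \<open>log N\<close>. They are found among the prime divisors of the numbers
\<open>4 i\<^sup>2 + 1\<close>, \<open>i \<le> y\<close>. Comparing the factorisation of the product of these numbers with that of
\<open>(fact y)\<^sup>2\<close>, in the style of Chebyshev, gives \<open>2 ^ y \<le> Q ^ k\<close> for the number \<open>k\<close> of these
primes, where \<open>Q = 4 y\<^sup>2 + 1\<close> bounds each of them
(\<open>two_power_le_power_card_prime_factors\<close>). The choice of \<open>y\<close> is the first integer above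
\<open>log N / log 2\<close>.\<close>

section \<open>Progressions in directions of equal length\<close>

text \<open>Count triples \<open>(t, j, j')\<close> for which both \<open>t + j s\<close> and \<open>t + j' s\<close> lie in \<open>A\<close>. For a fixed direction \<open>s\<close>, the set \<open>A\<close> is hit
\<open>M * card A\<close> times in total by the progressions starting in \<open>T\<close>, so Cauchy--Schwarz bounds the
number of triples from below by \<open>(M * card A)\<^sup>2 / card T\<close>. From above, an off-diagonal triple
is determined, together with its direction, by the point \<open>t + j s\<close>, the step \<open>j' - j\<close> and
\<open>j\<close>: this is what uniqueness of the direction gives. The upper bound therefore
does not grow with the number of directions, except for the diagonal \<open>j = j'\<close>.\<close>

lemma card_le_of_unique_progression_direction:
  fixes A S T :: "'a::real_vector set" and M :: nat
  assumes fin: "finite A" "finite S" "finite T"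
    and T: "\<And>a s j. a \<in> A \<Longrightarrow> s \<in> S \<Longrightarrow> j \<in> {1..int M} \<Longrightarrow> a - of_int j *\<^sub>R s \<in> T"
    and unique: "\<And>a s s' m. a \<in> A \<Longrightarrow> s \<in> S \<Longrightarrow> s' \<in> S \<Longrightarrow> m \<noteq> 0 \<Longrightarrow>
      a + of_int m *\<^sub>R s \<in> A \<Longrightarrow> a + of_int m *\<^sub>R s' \<in> A \<Longrightarrow> s = s'"
  shows "card S * (M * card A) \<le> card T * (card S + 2 * M)"
proof (cases "M * card A = 0")
  case False
  define J where "J = {1..int M}"
  define H where "H = (\<lambda>s t. {j\<in>J. t + of_int j *\<^sub>R s \<in> A})"
  have finJ: "finite J" and cardJ: "card J = M" by (auto simp: J_def)
  have finH: "finite (H s t)" for s t by (simp add: H_def finJ)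
  have hits: "(\<Sum>t\<in>T. card (H s t)) = M * card A" if s: "s \<in> S" for s
  proof -
    have "(\<Sum>t\<in>T. card (H s t)) = card (Sigma T (H s))"
      using fin finH by simp
    also have "\<dots> = card (A \<times> J)"
    proof (rule bij_betw_same_card[symmetric])
      show "bij_betw (\<lambda>(a, j). (a - of_int j *\<^sub>R s, j)) (A \<times> J) (Sigma T (H s))"
        by (rule bij_betw_byWitness[where f' = "\<lambda>(t, j). (t + of_int j *\<^sub>R s, j)"])
           (use T s in \<open>auto simp: H_def J_def\<close>)
    qed
    finally show ?thesis using cardJ by (simp add: card_cartesian_product)
  qed
  \<comment> \<open>the off-diagonal triples, over all directions at once\<close>
  define D where "D = (SIGMA (s, t):S \<times> T. {(j, j'). j \<in> H s t \<and> j' \<in> H s t \<and> j \<noteq> j'})"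
  have card_off: "card {(j, j'). j \<in> H s t \<and> j' \<in> H s t \<and> j \<noteq> j'} + card (H s t) = (card (H s t))\<^sup>2" for s t
  proof -
    let ?O = "{(j, j'). j \<in> H s t \<and> j' \<in> H s t \<and> j \<noteq> j'}" and ?I = "(\<lambda>j. (j, j)) ` H s t"
    have "card ?I = card (H s t)" by (intro card_image) (auto simp: inj_on_def)
    moreover have "H s t \<times> H s t = ?O \<union> ?I" by auto
    moreover have "card (?O \<union> ?I) = card ?O + card ?I"
      by (rule card_Un_disjoint)
         (auto intro: finite_subset[of _ "H s t \<times> H s t"] finH)
    ultimately have "card (H s t \<times> H s t) = card ?O + card (H s t)" by (simp only:)
    then show ?thesis by (simp only: card_cartesian_product power2_eq_square)
  qed
  have finO: "finite {(j, j'). j \<in> H s t \<and> j' \<in> H s t \<and> j \<noteq> j'}" for s t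
    by (rule finite_subset[of _ "H s t \<times> H s t"]) (auto simp: finH)
  have "card D + card S * (M * card A) = (\<Sum>(s, t)\<in>S \<times> T. (card (H s t))\<^sup>2)"
  proof -
    have "card D = (\<Sum>(s, t)\<in>S \<times> T. card {(j, j'). j \<in> H s t \<and> j' \<in> H s t \<and> j \<noteq> j'})"
      unfolding D_def using fin finO by (subst card_SigmaI) (auto simp: split_def)
    moreover have "card S * (M * card A) = (\<Sum>(s, t)\<in>S \<times> T. card (H s t))"
      by (simp add: hits flip: sum.cartesian_product)
    moreover have "(\<Sum>(s, t)\<in>S \<times> T. card {(j, j'). j \<in> H s t \<and> j' \<in> H s t \<and> j \<noteq> j'}) + (\<Sum>(s, t)\<in>S \<times> T. card (H s t))
      = (\<Sum>(s, t)\<in>S \<times> T. (card (H s t))\<^sup>2)"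
      unfolding sum.distrib[symmetric] by (intro sum.cong refl) (clarify, rule card_off)
    ultimately show ?thesis by simp
  qed
  moreover have "card D \<le> 2 * M * (M * card A)"
  proof -
    \<comment> \<open>the encoding by first point, step and first index; it forgets the direction\<close>
    define E where "E = (\<lambda>((s :: 'a, t :: 'a), (j :: int, j' :: int)). (t + of_int j *\<^sub>R s, j' - j, j))"
    have inD: "t + of_int j *\<^sub>R s \<in> A" "(t + of_int j *\<^sub>R s) + of_int (j' - j) *\<^sub>R s \<in> A"
      "j \<in> J" "j' \<in> J" "j' - j \<noteq> 0" "s \<in> S"
      if "((s, t), (j, j')) \<in> D" for s t j j'
      using that by (auto simp: D_def H_def algebra_simps)
    have "inj_on E D"
    proof (rule inj_onI)
      fix x x' assume x: "x \<in> D" "x' \<in> D" "E x = E x'"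
      obtain s t j j' where xe: "x = ((s, t), (j, j'))" by (metis prod.exhaust)
      obtain s' t' k k' where xe': "x' = ((s', t'), (k, k'))" by (metis prod.exhaust)
      note 1 = x(1)[unfolded xe] and 2 = x(2)[unfolded xe']
      from x(3) xe xe' have eq: "t + of_int j *\<^sub>R s = t' + of_int k *\<^sub>R s'" "j' - j = k' - k" "j = k"
        by (auto simp: E_def)
      have "s = s'"
        by (rule unique[of "t + of_int j *\<^sub>R s" s s' "j' - j"])
           (use inD[OF 1] inD[OF 2] eq in auto)
      with eq show "x = x'" by (simp add: xe xe')
    qed
    moreover have "E ` D \<subseteq> A \<times> {1 - int M..int M} \<times> J"
    proof (rule image_subsetI)
      fix x assume x: "x \<in> D"
      obtain s t j j' where xe: "x = ((s, t), (j, j'))" by (metis prod.exhaust)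
      show "E x \<in> A \<times> {1 - int M..int M} \<times> J"
        using inD[of s t j j'] x by (auto simp: E_def J_def xe)
    qed
    ultimately have "card D \<le> card (A \<times> {1 - int M..int M} \<times> J)"
      using fin finJ by (intro card_inj_on_le) auto
    moreover have "card {1 - int M..int M} = 2 * M" by simp
    ultimately show ?thesis by (simp only: card_cartesian_product cardJ mult_ac)
  qed
  ultimately have upper: "(\<Sum>(s, t)\<in>S \<times> T. (card (H s t))\<^sup>2) \<le> (card S + 2 * M) * (M * card A)"
    by (simp add: algebra_simps)
  have "card S * (M * card A)\<^sup>2 = (\<Sum>s\<in>S. (\<Sum>t\<in>T. card (H s t))\<^sup>2)"
    by (simp add: hits)
  also have "\<dots> \<le> (\<Sum>s\<in>S. card T * (\<Sum>t\<in>T. (card (H s t))\<^sup>2))"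
  proof (rule sum_mono)
    fix s
    have "(\<Sum>t\<in>T. real (card (H s t)))\<^sup>2 \<le> real (card T) * (\<Sum>t\<in>T. (real (card (H s t)))\<^sup>2)"
      using sum_squared_le_sum_of_squares[of "\<lambda>t. real (card (H s t))" T] by (simp only: mult.commute)
    then have "real ((\<Sum>t\<in>T. card (H s t))\<^sup>2) \<le> real (card T * (\<Sum>t\<in>T. (card (H s t))\<^sup>2))" by simp
    then show "(\<Sum>t\<in>T. card (H s t))\<^sup>2 \<le> card T * (\<Sum>t\<in>T. (card (H s t))\<^sup>2)"
      by (simp only: of_nat_le_iff)
  qed
  also have "\<dots> = card T * (\<Sum>(s, t)\<in>S \<times> T. (card (H s t))\<^sup>2)"
    by (simp add: sum_distrib_left sum.cartesian_product split_def)
  also have "\<dots> \<le> card T * ((card S + 2 * M) * (M * card A))"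
    using upper by (rule mult_left_mono) simp
  finally have "(card S * (M * card A)) * (M * card A) \<le> (card T * (card S + 2 * M)) * (M * card A)"
    by (simp add: power2_eq_square mult_ac)
  then show ?thesis using False by (simp only: mult_le_cancel2 neq0_conv)
qed auto

section \<open>Prime divisors of the numbers $4i^2+1$\<close>

lemma multiplicity_eq_card_powers:
  fixes p m :: nat
  assumes "prime p" "m > 0" "m < p ^ Suc E"
  shows "multiplicity p m = card {a\<in>{1..E}. p ^ a dvd m}"
proof -
  have iff: "p ^ a dvd m \<longleftrightarrow> a \<le> multiplicity p m" for a
    using assms by (intro power_dvd_iff_le_multiplicity) auto
  have "p ^ multiplicity p m \<le> m"
    using assms by (simp add: dvd_imp_le multiplicity_dvd)
  then have "p ^ multiplicity p m < p ^ Suc E"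
    using assms(3) by simp
  then have "multiplicity p m < Suc E"
    using prime_gt_1_nat[OF assms(1)] by (metis power_less_imp_less_exp)
  then have "{a\<in>{1..E}. p ^ a dvd m} = {1..multiplicity p m}"
    by (auto simp: iff)
  then show ?thesis by simp
qed

text \<open>Legendre's formula, for the product of an arbitrary function: it is applied both to the factorial
and to the product of the values \<open>4 i\<^sup>2 + 1\<close>, which makes the two multiplicities comparable.\<close>

lemma multiplicity_prod_eq_sum_card:
  fixes p :: nat and f :: "nat \<Rightarrow> nat"
  assumes "prime p" "finite A" "\<And>i. i \<in> A \<Longrightarrow> 0 < f i \<and> f i < p ^ Suc E"
  shows "multiplicity p (\<Prod>i\<in>A. f i) = (\<Sum>a=1..E. card {i\<in>A. p ^ a dvd f i})"
proof -
  have "0 \<notin> f ` A"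
    using assms(3) by (metis imageE less_irrefl)
  then have "multiplicity p (\<Prod>i\<in>A. f i) = (\<Sum>i\<in>A. multiplicity p (f i))"
    using assms(1,2) by (intro prime_elem_multiplicity_prod_distrib) (auto simp: prime_imp_prime_elem)
  also have "\<dots> = (\<Sum>i\<in>A. card {a\<in>{1..E}. p ^ a dvd f i})"
    using assms by (intro sum.cong refl multiplicity_eq_card_powers) auto
  also have "\<dots> = (\<Sum>a=1..E. card {i\<in>A. p ^ a dvd f i})"
    using assms(2) by (intro sum_multicount_gen) auto
  finally show ?thesis .
qed

lemma card_residue_class_le:
  fixes q y :: nat and r :: int
  assumes "q > 0"
  shows "card {i\<in>{1..y}. [int i = r] (mod int q)} \<le> y div q + 1"
proof -
  let ?C = "{i\<in>{1..y}. [int i = r] (mod int q)}"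
  have "inj_on (\<lambda>i. i div q) ?C"
  proof (rule inj_onI)
    fix i j assume ij: "i \<in> ?C" "j \<in> ?C" "i div q = j div q"
    then have "[int i = int j] (mod int q)"
      by (auto intro: cong_trans cong_sym)
    then have "i mod q = j mod q"
      by (simp only: cong_int_iff) (simp add: cong_def)
    with ij(3) show "i = j"
      by (metis div_mult_mod_eq)
  qed
  moreover have "(\<lambda>i. i div q) ` ?C \<subseteq> {0..y div q}"
    by (auto intro: div_le_mono)
  ultimately have "card ?C \<le> card {0..y div q}"
    by (intro card_inj_on_le) auto
  then show ?thesis by simp
qed

text \<open>If \<open>i\<close> and \<open>r\<close> are both roots of \<open>4 x\<^sup>2 + 1\<close> modulo \<open>p ^ a\<close>, then \<open>p ^ a\<close> divides
\<open>4 (i - r) (i + r)\<close>. If \<open>a > 0\<close>, then \<open>p\<close> is odd and cannot divide both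
\<open>2 (i - r)\<close> and \<open>2 (i + r)\<close>, for it would divide
\<open>4 i\<^sup>2\<close> and hence \<open>1\<close>. So all roots lie in the two residue classes of \<open>r\<close> and \<open>- r\<close>.\<close>

lemma card_roots_le:
  fixes p y a :: nat
  assumes p: "prime p"
  shows "card {i\<in>{1..y}. p ^ a dvd 4 * i\<^sup>2 + 1} \<le> 2 * (y div p ^ a) + 2"
proof (cases "{i\<in>{1..y}. p ^ a dvd 4 * i\<^sup>2 + 1} = {} \<or> a = 0")
  case True
  then show ?thesis
  proof
    assume "a = 0"
    have "card {i\<in>{1..y}. p ^ a dvd 4 * i\<^sup>2 + 1} \<le> card {1..y}"
      by (intro card_mono) auto
    with \<open>a = 0\<close> show ?thesis by simp
  qed (metis card.empty le0)
next
  case False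
  let ?q = "p ^ a" and ?R = "{i\<in>{1..y}. p ^ a dvd 4 * i\<^sup>2 + 1}"
  from False obtain r where "r \<in> ?R" and a0: "a > 0" by auto
  then have r: "?q dvd 4 * r\<^sup>2 + 1" by simp
  have q0: "?q > 0" using prime_gt_0_nat[OF p] by simp
  have "?R \<subseteq> {i\<in>{1..y}. [int i = int r] (mod int ?q)} \<union> {i\<in>{1..y}. [int i = - int r] (mod int ?q)}"
  proof
    fix i assume i: "i \<in> ?R"
    have pdvd: "int p dvd 4 * (int i)\<^sup>2 + 1"
    proof -
      have "p dvd 4 * i\<^sup>2 + 1"
        using i dvd_power[OF disjI1[OF a0], of p] by (auto elim: dvd_trans)
      then have "int p dvd int (4 * i\<^sup>2 + 1)" by (simp only: int_dvd_int_iff)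
      then show ?thesis by (simp add: add.commute)
    qed
    have "int ?q dvd int (4 * i\<^sup>2 + 1) - int (4 * r\<^sup>2 + 1)"
      using i r by (intro dvd_diff) (simp_all only: int_dvd_int_iff mem_Collect_eq)
    also have "\<dots> = (2 * (int i - int r)) * (2 * (int i + int r))"
      by (simp add: power2_eq_square algebra_simps)
    finally have dvd: "int p ^ a dvd (2 * (int i - int r)) * (2 * (int i + int r))" by simp
    have not_both: "\<not> (int p dvd 2 * (int i - int r) \<and> int p dvd 2 * (int i + int r))"
    proof
      assume "int p dvd 2 * (int i - int r) \<and> int p dvd 2 * (int i + int r)"
      then have "int p dvd 2 * (int i - int r) + 2 * (int i + int r)" by (intro dvd_add) auto
      then have "int p dvd (2 * (int i - int r) + 2 * (int i + int r)) * int i" by (rule dvd_mult2)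
      then have "int p dvd 4 * (int i)\<^sup>2" by (simp add: power2_eq_square algebra_simps)
      with pdvd have "int p dvd 1" by (metis dvd_add_right_iff)
      then show False using p by simp
    qed
    have p_odd: "\<not> int p dvd 2"
    proof
      assume "int p dvd 2"
      then have "int p dvd 4 * (int i)\<^sup>2"
        using dvd_mult2[of "int p" 2 "2 * (int i)\<^sup>2"] by simp
      with pdvd have "int p dvd 1" by (metis dvd_add_right_iff)
      then show False using p by simp
    qed
    have cop2: "coprime (int p ^ a) 2"
      using p p_odd by (intro coprime_power_left_iff[THEN iffD2] disjI1 prime_imp_coprime) auto
    have "int p ^ a dvd 2 * (int i - int r) \<or> int p ^ a dvd 2 * (int i + int r)"
    proof (cases "int p dvd 2 * (int i - int r)")
      case True
      with not_both have "coprime (int p ^ a) (2 * (int i + int r))"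
        using p by (intro coprime_power_left_iff[THEN iffD2] disjI1 prime_imp_coprime) auto
      with dvd show ?thesis by (simp add: coprime_dvd_mult_left_iff)
    next
      case False
      then have "coprime (int p ^ a) (2 * (int i - int r))"
        using p by (intro coprime_power_left_iff[THEN iffD2] disjI1 prime_imp_coprime) auto
      with dvd show ?thesis by (simp add: coprime_dvd_mult_right_iff)
    qed
    then have "int p ^ a dvd int i - int r \<or> int p ^ a dvd int i + int r"
      using coprime_dvd_mult_right_iff[OF cop2] by blast
    then show "i \<in> {i\<in>{1..y}. [int i = int r] (mod int ?q)} \<union> {i\<in>{1..y}. [int i = - int r] (mod int ?q)}"
      using i by (auto simp: cong_iff_dvd_diff)
  qed
  then have "card ?R \<le> card ({i\<in>{1..y}. [int i = int r] (mod int ?q)} \<union> {i\<in>{1..y}. [int i = - int r] (mod int ?q)})"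
    by (intro card_mono) auto
  also have "\<dots> \<le> (y div ?q + 1) + (y div ?q + 1)"
    by (intro order.trans[OF card_Un_le] add_mono card_residue_class_le q0)
  finally show ?thesis by simp
qed

lemma card_multiples:
  fixes q y :: nat assumes "q > 0"
  shows "card {i\<in>{1..y}. q dvd i} = y div q"
proof -
  have "{i\<in>{1..y}. q dvd i} = (\<lambda>j. q * j) ` {1..y div q}"
    using assms by (auto simp: less_eq_div_iff_mult_less_eq dvd_def mult.commute intro!: imageI)
  moreover have "inj_on (\<lambda>j. q * j) {1..y div q}" using assms by (auto simp: inj_on_def)
  ultimately show ?thesis by (simp add: card_image)
qed

definition norm_product :: "nat \<Rightarrow> nat" where
  "norm_product y = (\<Prod>i=1..y. 4 * i\<^sup>2 + 1)"

text \<open>Each power \<open>p ^ a\<close> divides at most \<open>2 * (y div p ^ a) + 2\<close> of the values \<open>4 i\<^sup>2 + 1\<close>, against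
exactly \<open>y div p ^ a\<close> of the numbers \<open>1, \<dots>, y\<close>. Summed over \<open>a\<close>, the main terms give twice
the multiplicity in \<open>fact y\<close>. The rounding errors contribute \<open>2 E\<close>, where \<open>p ^ E\<close> is the largest
power of \<open>p\<close> that can divide one of the values.\<close>

lemma prime_power_norm_product_le:
  fixes p y :: nat
  assumes p: "prime p" and y: "y > 0"
  shows "p ^ multiplicity p (norm_product y)
    \<le> (p ^ multiplicity p (fact y :: nat))\<^sup>2 * (4 * y\<^sup>2 + 1)\<^sup>2"
proof -
  obtain E where E: "p ^ E \<le> 4 * y\<^sup>2 + 1" "4 * y\<^sup>2 + 1 < p ^ Suc E"
    using ex_power_ivl1[of p "4 * y\<^sup>2 + 1"] prime_ge_2_nat[OF p] by auto
  have le: "4 * i\<^sup>2 + 1 \<le> 4 * y\<^sup>2 + 1" "i \<le> 4 * i\<^sup>2 + 1" if "i \<in> {1..y}" for i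
    using that by (auto simp: power2_eq_square intro: mult_le_mono order.trans[of i "i*i"])
  have "multiplicity p (norm_product y) = (\<Sum>a=1..E. card {i\<in>{1..y}. p ^ a dvd 4 * i\<^sup>2 + 1})"
    unfolding norm_product_def
    by (intro multiplicity_prod_eq_sum_card p conjI order.strict_trans1[OF le(1) E(2)]) auto
  also have "\<dots> \<le> (\<Sum>a=1..E. 2 * (y div p ^ a) + 2)"
    by (intro sum_mono card_roots_le p)
  also have "\<dots> = 2 * (\<Sum>a=1..E. card {i\<in>{1..y}. p ^ a dvd i}) + 2 * E"
    using prime_gt_0_nat[OF p] by (simp only: sum.distrib sum_distrib_left card_multiples zero_less_power) simp
  also have "(\<Sum>a=1..E. card {i\<in>{1..y}. p ^ a dvd i}) = multiplicity p (\<Prod>{1..y})"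
    by (rule multiplicity_prod_eq_sum_card[symmetric])
      (use p order.strict_trans1[OF order.trans[OF le(2) le(1)] E(2)] in auto)
  finally have "multiplicity p (norm_product y) \<le> 2 * multiplicity p (fact y :: nat) + 2 * E"
    by (simp add: fact_prod)
  then have "p ^ multiplicity p (norm_product y) \<le> p ^ (2 * multiplicity p (fact y :: nat) + 2 * E)"
    using prime_ge_1_nat[OF p] by (intro power_increasing) auto
  also have "\<dots> = (p ^ multiplicity p (fact y :: nat))\<^sup>2 * (p ^ E)\<^sup>2"
    by (simp add: power_add power_mult mult.commute flip: power_mult)
  also have "\<dots> \<le> (p ^ multiplicity p (fact y :: nat))\<^sup>2 * (4 * y\<^sup>2 + 1)\<^sup>2"
    using E(1) by (intro mult_left_mono power_mono) auto
  finally show ?thesis .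
qed

text \<open>This is the source of small primes congruent to \<open>1\<close> modulo \<open>4\<close>; it replaces the theorem on primes in
arithmetic progressions. The product of the \<open>4 i\<^sup>2 + 1\<close> exceeds \<open>4 ^ y * (fact y)\<^sup>2\<close>, while its
prime powers multiply to at most \<open>(fact y)\<^sup>2\<close>, times \<open>(4 y\<^sup>2 + 1)\<^sup>2\<close> for every prime
involved. The factor \<open>4 ^ y\<close> can only be made up by many primes.\<close>

lemma two_power_le_power_card_prime_factors:
  fixes y :: nat
  assumes y: "y > 0"
  shows "2 ^ y \<le> (4 * y\<^sup>2 + 1) ^ card (prime_factors (norm_product y))"
proof -
  let ?P = "prime_factors (norm_product y)" and ?Q = "4 * y\<^sup>2 + 1"
  have pos: "norm_product y > 0" by (simp add: norm_product_def)
  have "(2 ^ y * fact y)\<^sup>2 = (\<Prod>i=1..y. 4 * i\<^sup>2 :: nat)"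
    by (simp add: prod.distrib fact_prod power_mult_distrib flip: power_mult prod_power_distrib)
       (simp add: power_mult mult.commute[of y])
  also have "\<dots> \<le> norm_product y" unfolding norm_product_def by (intro prod_mono) auto
  also have "\<dots> = (\<Prod>p\<in>?P. p ^ multiplicity p (norm_product y))"
    using pos by (simp add: prime_factorization_nat)
  also have "\<dots> \<le> (\<Prod>p\<in>?P. (p ^ multiplicity p (fact y :: nat))\<^sup>2 * ?Q\<^sup>2)"
    using y by (intro prod_mono conjI prime_power_norm_product_le) auto
  also have "\<dots> = (\<Prod>p\<in>?P. p ^ multiplicity p (fact y :: nat))\<^sup>2 * (?Q ^ card ?P)\<^sup>2"
    by (simp only: prod.distrib prod_power_distrib prod_constant)
       (simp flip: power_mult add: mult.commute)
  also have "(\<Prod>p\<in>?P. p ^ multiplicity p (fact y :: nat)) \<le> fact y"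
  proof (rule dvd_imp_le)
    show "(\<Prod>p\<in>?P. p ^ multiplicity p (fact y :: nat)) dvd fact y"
      by (rule multiplicity_le_imp_dvd)
         (auto simp: multiplicity_prod_prime_powers in_prime_factors_imp_prime)
  qed simp
  finally have "(2 ^ y * fact y)\<^sup>2 \<le> (fact y * ?Q ^ card ?P)\<^sup>2"
    by (simp add: power_mult_distrib power_mono)
  then have "fact y * 2 ^ y \<le> fact y * ?Q ^ card ?P"
    by (simp add: mult.commute power2_nat_le_eq_le)
  then show ?thesis by simp
qed

section \<open>Lattice points on circles\<close>

text \<open>Thue's argument: there are more than \<open>p\<close> pairs \<open>(u, v)\<close> with entries between \<open>0\<close> and
\<open>\<lfloor>sqrt p\<rfloor>\<close>, so two of them agree in \<open>u - t v\<close> modulo \<open>p\<close>. Their difference \<open>(a, b)\<close> satisfies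
\<open>a\<^sup>2 + b\<^sup>2 \<equiv> 0\<close> modulo \<open>p\<close>, and this sum lies strictly between \<open>0\<close> and \<open>2 p\<close>.\<close>

lemma prime_dvd_square_plus_one_imp_sum_two_squares:
  fixes p :: nat and t :: int
  assumes p: "prime p" and dvd: "int p dvd t\<^sup>2 + 1"
  shows "\<exists>a b. int p = a\<^sup>2 + b\<^sup>2"
proof -
  define s where "s = floor_sqrt p"
  have p0: "p > 0" using p prime_gt_0_nat by blast
  have "s\<^sup>2 \<le> p" by (simp add: s_def floor_sqrt_power2_le)
  moreover have "s\<^sup>2 \<noteq> p" using p by (metis prime_power_iff numeral_eq_one_iff semiring_norm(85))
  ultimately have s1: "s\<^sup>2 < p" by simp
  have s2: "p < (s + 1)\<^sup>2" using Suc_floor_sqrt_power2_gt[of p] by (simp add: s_def)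
  let ?B = "{0..int s} \<times> {0..int s}"
  define h where "h = (\<lambda>(u, v). (u - t * v) mod int p)"
  have "h ` ?B \<subseteq> {0..<int p}" using p0 by (auto simp: h_def)
  then have "card (h ` ?B) \<le> p" using card_mono[of "{0..<int p}" "h ` ?B"] by simp
  also have "\<dots> < card ?B"
  proof -
    have "card {0..int s} = s + 1" by simp
    then show ?thesis using s2 by (simp only: card_cartesian_product power2_eq_square)
  qed
  finally have "\<not> inj_on h ?B" by (rule pigeonhole)
  then obtain z w where zw: "z \<in> ?B" "w \<in> ?B" "z \<noteq> w" "h z = h w"
    unfolding inj_on_def by blast
  obtain u v u' v' where "z = (u, v)" "w = (u', v')" by (cases z, cases w)
  with zw have uv: "(u, v) \<in> ?B" "(u', v') \<in> ?B" "(u, v) \<noteq> (u', v')" "h (u, v) = h (u', v')"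
    by simp_all
  define a b where "a = u - u'" and "b = v - v'"
  have "int p dvd (u - t * v) - (u' - t * v')"
    using uv(4) by (simp add: h_def mod_eq_dvd_iff)
  then have d: "int p dvd a - t * b" by (simp add: a_def b_def algebra_simps)
  have "a\<^sup>2 + b\<^sup>2 = (a - t * b) * (a + t * b) + (t\<^sup>2 + 1) * b\<^sup>2" by (simp add: power2_eq_square algebra_simps)
  then have pd: "int p dvd a\<^sup>2 + b\<^sup>2" using d dvd by simp
  have "\<bar>a\<bar> \<le> int s" "\<bar>b\<bar> \<le> int s" using uv by (auto simp: a_def b_def)
  then have "a\<^sup>2 \<le> (int s)\<^sup>2" "b\<^sup>2 \<le> (int s)\<^sup>2" by (simp_all add: abs_le_square_iff[symmetric])
  moreover have "(int s)\<^sup>2 < int p" using s1 by (metis of_nat_less_iff of_nat_power)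
  ultimately have lt: "a\<^sup>2 + b\<^sup>2 < 2 * int p" by linarith
  have pos: "a\<^sup>2 + b\<^sup>2 > 0" using uv(3) by (auto simp: a_def b_def sum_power2_gt_zero_iff)
  from pd obtain c where c: "a\<^sup>2 + b\<^sup>2 = int p * c" by (auto simp: dvd_def)
  with pos lt p0 have "0 < c" "c < 2" by (auto simp: zero_less_mult_iff mult.commute)
  then have "c = 1" by simp
  with c show ?thesis by (metis mult.right_neutral)
qed

definition circle_points :: "int \<Rightarrow> (int \<times> int) set" where
  "circle_points n = {(x, y). x\<^sup>2 + y\<^sup>2 = n}"

lemma finite_circle_points: "finite (circle_points n)"
proof (rule finite_subset)
  have "\<bar>x\<bar> \<le> n" if "x\<^sup>2 + y\<^sup>2 = n" for x y :: int
  proof -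
    have "\<bar>x\<bar> * 1 \<le> \<bar>x\<bar> * \<bar>x\<bar>"
    proof (cases "x = 0")
      case False
      then show ?thesis by (intro mult_left_mono) auto
    qed simp
    then have "\<bar>x\<bar> \<le> x\<^sup>2" by (simp add: power2_eq_square)
    with that show ?thesis using zero_le_power2[of y] by linarith
  qed
  note bound = this
  have "x \<in> {-n..n} \<and> y \<in> {-n..n}" if "x\<^sup>2 + y\<^sup>2 = n" for x y :: int
    using bound[of x y] bound[of y x] that by (simp add: add.commute abs_le_iff)
  then show "circle_points n \<subseteq> {-n..n} \<times> {-n..n}"
    unfolding circle_points_def by blast
qed simp

text \<open>In Gaussian integers, the maps \<open>f\<close> and \<open>g\<close> of the proof multiply by \<open>a + b i\<close> and by its conjugate.
They send the circle of norm \<open>n\<close> into that of norm \<open>p n\<close> injectively, because composing them is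
multiplication by \<open>p\<close>. Their images are disjoint: if \<open>(a + b i) w = (a - b i) z\<close>, then
multiplication by \<open>a + b i\<close> shows that \<open>p\<close> divides \<open>(a + b i)\<^sup>2 w\<close>. Since
\<open>(a + b i)\<^sup>2 = 2 a (a + b i) - p\<close> and \<open>p\<close> does not divide \<open>2 a\<close>, it divides \<open>(a + b i) w\<close>,
whose norm is \<open>p n\<close>. Hence \<open>p\<^sup>2\<close> divides \<open>p n\<close>, contrary to the assumption on \<open>n\<close>.\<close>

lemma card_circle_points_prime_mult:
  fixes p n :: int
  assumes p: "prime p" "p \<noteq> 2" "p = a\<^sup>2 + b\<^sup>2" and n: "\<not> p dvd n"
  shows "2 * card (circle_points n) \<le> card (circle_points (p * n))"
proof -
  define f where "f = (\<lambda>(x, y). (a * x - b * y, a * y + b * x))"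
  define g where "g = (\<lambda>(x, y). (a * x + b * y, a * y - b * x))"
  have p0: "p > 0" using p(1) by (simp add: prime_gt_0_int)
  have gf: "g (f z) = (p * fst z, p * snd z)" and fg: "f (g z) = (p * fst z, p * snd z)" for z
    by (auto simp: f_def g_def p(3) split_def power2_eq_square algebra_simps)
  have inj: "inj f" "inj g"
  proof -
    have scale: "z = w" if "(p * fst z, p * snd z) = (p * fst w, p * snd w)" for z w :: "int \<times> int"
      using that p0 by (simp add: prod_eq_iff)
    show "inj f" by (rule injI, rule scale) (simp flip: gf)
    show "inj g" by (rule injI, rule scale) (simp flip: fg)
  qed
  have sub: "f ` circle_points n \<subseteq> circle_points (p * n)" "g ` circle_points n \<subseteq> circle_points (p * n)"
    by (auto simp: f_def g_def circle_points_def p(3) power2_eq_square algebra_simps)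
  have small: "\<not> p dvd 2 * a"
  proof
    assume "p dvd 2 * a"
    moreover have "\<not> p dvd 2" using p(1,2) by (metis primes_dvd_imp_eq two_is_prime_nat prime_int_numeral_eq)
    ultimately have pa: "p dvd a" using p(1) prime_dvd_mult_iff by blast
    then have "p dvd p - a\<^sup>2" by (intro dvd_diff) (auto simp: power2_eq_square)
    then have pb: "p dvd b" using p(1,3) prime_dvd_power by auto
    from pa pb have "p * p dvd a\<^sup>2 + b\<^sup>2" by (auto simp: power2_eq_square intro!: dvd_add mult_dvd_mono)
    then have "p * p dvd p * 1" using p(3) by simp
    then show False using p(1) p0 by (metis dvd_times_left_cancel_iff less_irrefl not_prime_unit)
  qed
  have disj: "f ` circle_points n \<inter> g ` circle_points n = {}"
  proof (rule ccontr)
    assume "f ` circle_points n \<inter> g ` circle_points n \<noteq> {}"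
    then obtain w z where w: "w \<in> circle_points n" "f w = g z" by blast
    obtain x y where "w = (x, y)" by (cases w)
    with w have z: "(x, y) \<in> circle_points n" "f (x, y) = g z" by simp_all
    \<comment> \<open>the coordinates of the common point, that is, of \<open>(a + b i) w\<close>\<close>
    define X Y where "X = a * x - b * y" and "Y = a * y + b * x"
    have "f (X, Y) = (p * fst z, p * snd z)" using z(2) fg[of z] by (simp add: f_def X_def Y_def)
    then have e: "a * X - b * Y = p * fst z" "a * Y + b * X = p * snd z" by (auto simp: f_def)
    have "2 * a * X = (a * X - b * Y) + p * x" "2 * a * Y = (a * Y + b * X) + p * y"
      by (simp_all add: X_def Y_def p(3) power2_eq_square algebra_simps)
    then have "p dvd 2 * a * X" "p dvd 2 * a * Y" by (simp_all add: e)
    then have "p dvd X" "p dvd Y" using small p(1) prime_dvd_mult_iff by blast+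
    then have "p * p dvd X\<^sup>2 + Y\<^sup>2" by (auto simp: power2_eq_square intro!: dvd_add mult_dvd_mono)
    also have "X\<^sup>2 + Y\<^sup>2 = p * n"
      using z(1) sub(1) by (auto simp: X_def Y_def f_def circle_points_def)
    finally show False using n p0 by simp
  qed
  have "2 * card (circle_points n) = card (f ` circle_points n) + card (g ` circle_points n)"
    using inj by (simp add: card_image inj_on_subset)
  also have "\<dots> = card (f ` circle_points n \<union> g ` circle_points n)"
    using disj by (intro card_Un_disjoint[symmetric] finite_imageI finite_circle_points)
  also have "\<dots> \<le> card (circle_points (p * n))"
    using sub by (intro card_mono finite_circle_points) auto
  finally show ?thesis .
qed

lemma card_circle_points_prod_primes:
  fixes P :: "nat set"
  assumes "finite P" "\<And>p. p \<in> P \<Longrightarrow> prime p \<and> p \<noteq> 2 \<and> (\<exists>t. int p dvd t\<^sup>2 + 1)"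
  shows "2 ^ card P \<le> card (circle_points (int (\<Prod>P)))"
  using assms
proof (induction P)
  case empty
  have "(1, 0) \<in> circle_points 1" by (simp add: circle_points_def)
  then have "card (circle_points 1) > 0" using finite_circle_points by (auto simp: card_gt_0_iff)
  then show ?case by simp
next
  case (insert p P)
  obtain t where t: "prime p" "p \<noteq> 2" "int p dvd t\<^sup>2 + 1" using insert.prems by blast
  obtain a b where ab: "int p = a\<^sup>2 + b\<^sup>2"
    using prime_dvd_square_plus_one_imp_sum_two_squares t by blast
  have "\<not> p dvd \<Prod>P"
  proof
    assume "p dvd \<Prod>P"
    then obtain q where "q \<in> P" "p dvd q" using t(1) insert.hyps(1) by (auto simp: prime_dvd_prod_iff)
    with insert.prems t(1) have "p = q" by (metis insertCI primes_dvd_imp_eq)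
    with \<open>q \<in> P\<close> insert.hyps show False by simp
  qed
  then have nd: "\<not> int p dvd int (\<Prod>P)" by (simp only: int_dvd_int_iff not_False_eq_True)
  have "2 ^ card (insert p P) \<le> 2 * card (circle_points (int (\<Prod>P)))"
    using insert by simp
  also have "\<dots> \<le> card (circle_points (int p * int (\<Prod>P)))"
    using t by (intro card_circle_points_prime_mult[OF _ _ ab nd]) auto
  finally show ?case using insert.hyps by simp
qed

section \<open>Isosceles-free subsets of the grid\<close>

text \<open>All the primes that divide the product of the \<open>4 i\<^sup>2 + 1\<close>, \<open>i \<le> y\<close>, are at most
\<open>Q = 4 y\<^sup>2 + 1\<close>, and if \<open>N \<le> 2 ^ y\<close> there are at least \<open>k\<close> of them, where
\<open>k\<close> is maximal with \<open>Q ^ k \<le> N\<close>. The product \<open>n\<close> of \<open>k\<close> of them is at most \<open>N\<close>. With \<open>y\<close> of order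
\<open>log N\<close> this makes \<open>k\<close> of order \<open>log N / log log N\<close>.\<close>

lemma exists_rich_circle:
  fixes N y :: nat
  assumes N: "N > 0" "N \<le> 2 ^ y" and y: "y > 0"
  obtains n k where "n > 0" "n \<le> N" "(4 * y\<^sup>2 + 1) ^ k \<le> N" "N < (4 * y\<^sup>2 + 1) ^ Suc k"
    "2 ^ k \<le> card (circle_points (int n))"
proof -
  let ?Q = "4 * y\<^sup>2 + 1"
  have Q: "?Q \<ge> 2" using y by (simp add: Suc_le_eq)
  then obtain k where k: "?Q ^ k \<le> N" "N < ?Q ^ Suc k"
    using ex_power_ivl1[of ?Q N] N by auto
  let ?P = "prime_factors (norm_product y)"
  have "?Q ^ k \<le> ?Q ^ card ?P"
    using k(1) N(2) two_power_le_power_card_prime_factors[OF y] by linarith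
  then have "k \<le> card ?P"
    by (rule power_le_imp_le_exp[rotated]) (use Q in linarith)
  then obtain P where P: "P \<subseteq> ?P" "card P = k" "finite P"
    by (rule obtain_subset_with_card_n)
  have prime_P: "prime p \<and> p \<noteq> 2 \<and> (\<exists>t. int p dvd t\<^sup>2 + 1) \<and> p \<le> ?Q" if "p \<in> P" for p
  proof -
    have pr: "prime p" and "p dvd norm_product y" using that P(1) by (auto simp: in_prime_factors_iff)
    then obtain i where i: "i \<in> {1..y}" "p dvd 4 * i\<^sup>2 + 1"
      by (auto simp: norm_product_def prime_dvd_prod_iff)
    have "p \<noteq> 2" using i(2) by auto
    moreover have "int p dvd int (4 * i\<^sup>2 + 1)" using i(2) by (simp only: int_dvd_int_iff)
    then have "int p dvd (2 * int i)\<^sup>2 + 1" by (simp add: power_mult_distrib add.commute)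
    moreover have "p \<le> ?Q"
    proof -
      have "p \<le> 4 * i\<^sup>2 + 1" using i(2) by (intro dvd_imp_le) auto
      also have "\<dots> \<le> ?Q" using i(1) by (simp add: power_mono)
      finally show ?thesis .
    qed
    ultimately show ?thesis using pr by blast
  qed
  show ?thesis
  proof (rule that[of "\<Prod>P" k])
    show "\<Prod>P > 0" using prime_P by (intro prod_pos) (auto intro: prime_gt_0_nat)
    have "\<Prod>P \<le> (\<Prod>p\<in>P. ?Q)" using prime_P by (intro prod_mono) auto
    with k(1) P(2) show "\<Prod>P \<le> N" by simp
    show "2 ^ k \<le> card (circle_points (int (\<Prod>P)))"
      using card_circle_points_prod_primes[OF P(3)] prime_P P(2) by blast
  qed (use k in auto)
qed

text \<open>If \<open>s\<close> and \<open>s'\<close> lie on the same circle about the origin, then \<open>a + m s\<close> and \<open>a + m s'\<close> are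
equidistant from \<open>a\<close>. So in an isosceles-free set, a point and a step determine the direction. The
hypotheses on \<open>n\<close> and \<open>M\<close> make all steps have length at most \<open>M * sqrt n \<le> N\<close>, so that the
progressions that meet the grid start in a square of side \<open>3 * N\<close>.\<close>

lemma isosceles_free_card_le:
  fixes A :: "(real \<times> real) set" and N M n :: nat
  assumes A: "A \<subseteq> grid N" "isosceles_free A" and n: "n > 0" "n \<le> N" and M: "M\<^sup>2 \<le> N"
  shows "card (circle_points (int n)) * (M * card A)
    \<le> (3 * N)\<^sup>2 * (card (circle_points (int n)) + 2 * M)"
proof -
  \<comment> \<open>the counting takes place in the real plane, where \<open>dist\<close> is Euclidean\<close>
  define emb where "emb = (\<lambda>(x, y). (real_of_int x, real_of_int y))"
  have inj: "inj_on emb B" for B by (auto simp: inj_on_def emb_def)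
  define S where "S = emb ` circle_points (int n)"
  define T where "T = emb ` ({1 - int N..2 * int N} \<times> {1 - int N..2 * int N})"
  have card_S: "card S = card (circle_points (int n))" by (simp add: S_def card_image inj)
  have "card {1 - int N..2 * int N} = 3 * N" by simp
  then have card_T: "card T = (3 * N)\<^sup>2"
    by (simp only: T_def card_image[OF inj] card_cartesian_product power2_eq_square)
  have norm_S: "norm s = sqrt n" if s: "s \<in> S" for s
  proof -
    obtain x y where xy: "s = (real_of_int x, real_of_int y)" "x\<^sup>2 + y\<^sup>2 = int n"
      using s by (auto simp: S_def emb_def circle_points_def)
    have "(real_of_int x)\<^sup>2 + (real_of_int y)\<^sup>2 = real n"
      using arg_cong[OF xy(2), of real_of_int] by simp
    then show ?thesis by (simp add: xy(1) norm_Pair)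
  qed
  have "card S * (M * card A) \<le> card T * (card S + 2 * M)"
  proof (rule card_le_of_unique_progression_direction)
    show "finite A" using A(1) by (rule finite_subset) (simp add: grid_def)
    show "finite S" by (simp add: S_def finite_circle_points)
    show "finite T" by (simp add: T_def)
  next
    fix a s :: "real \<times> real" and j :: int
    assume a: "a \<in> A" and s: "s \<in> S" and j: "j \<in> {1..int M}"
    obtain u v where uv: "a = (real u, real v)" "u \<in> {1..N}" "v \<in> {1..N}"
      using a A(1) by (auto simp: grid_def)
    obtain x y where xy: "s = (real_of_int x, real_of_int y)" "x\<^sup>2 + y\<^sup>2 = int n"
      using s by (auto simp: S_def emb_def circle_points_def)
    have small: "\<bar>j * z\<bar> \<le> int N" if "z\<^sup>2 \<le> int n" for z
    proof -
      have "(j * z)\<^sup>2 = j\<^sup>2 * z\<^sup>2" by (simp add: power_mult_distrib)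
      also have "\<dots> \<le> (int M)\<^sup>2 * int n"
        using j that by (intro mult_mono power_mono) auto
      also have "\<dots> \<le> int N * int N"
        using M n by (intro mult_mono) (auto simp flip: of_nat_power)
      finally have "(j * z)\<^sup>2 \<le> (int N)\<^sup>2" by (simp add: power2_eq_square)
      then have "\<bar>j * z\<bar> \<le> \<bar>int N\<bar>" by (simp only: abs_le_square_iff)
      then show ?thesis by (simp only: abs_of_nat)
    qed
    have "x\<^sup>2 \<le> int n" "y\<^sup>2 \<le> int n" using xy(2) zero_le_power2[of x] zero_le_power2[of y] by linarith+
    then have "\<bar>j * x\<bar> \<le> int N" "\<bar>j * y\<bar> \<le> int N" by (auto intro: small)
    then have "(int u - j * x, int v - j * y) \<in> {1 - int N..2 * int N} \<times> {1 - int N..2 * int N}"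
      using uv(2,3) by (auto simp: abs_le_iff)
    moreover have "a - of_int j *\<^sub>R s = emb (int u - j * x, int v - j * y)"
      by (simp add: uv(1) xy(1) emb_def)
    ultimately show "a - of_int j *\<^sub>R s \<in> T" unfolding T_def by blast
  next
    fix a s s' :: "real \<times> real" and m :: int
    assume a: "a \<in> A" and s: "s \<in> S" "s' \<in> S" and m: "m \<noteq> 0"
      and b: "a + of_int m *\<^sub>R s \<in> A" and c: "a + of_int m *\<^sub>R s' \<in> A"
    show "s = s'"
    proof (rule ccontr)
      assume "s \<noteq> s'"
      have "s \<noteq> 0" "s' \<noteq> 0" using norm_S[OF s(1)] norm_S[OF s(2)] n(1) by auto
      then have "isosceles_triangle a (a + of_int m *\<^sub>R s) (a + of_int m *\<^sub>R s')"
        using m \<open>s \<noteq> s'\<close> s by (simp add: isosceles_triangle_def dist_norm norm_S)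
      with A(2) a b c show False unfolding isosceles_free_def by blast
    qed
  qed
  then show ?thesis by (simp only: card_S card_T)
qed

text \<open>The progression bound reads \<open>card A \<le> 9 N\<^sup>2 (1 / M + 2 / K)\<close> with \<open>K\<close> points on the circle. The largest
admissible \<open>M\<close> is \<open>\<lfloor>sqrt N\<rfloor>\<close>. The term \<open>1 / M\<close> does no harm: since
\<open>4 ^ k \<le> Q ^ k \<le> N\<close>, also \<open>M\<close> is at least \<open>2 ^ k\<close>.\<close>

lemma isosceles_free_card_mult_power_le:
  fixes A :: "(real \<times> real) set" and N y :: nat
  assumes A: "A \<subseteq> grid N" "isosceles_free A" and N: "N > 0" "N \<le> 2 ^ y" and y: "y > 0"
  obtains k where "N < (4 * y\<^sup>2 + 1) ^ Suc k" "2 ^ Suc k * card A \<le> 54 * N\<^sup>2"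
proof -
  obtain n k where n: "n > 0" "n \<le> N" and k: "(4 * y\<^sup>2 + 1) ^ k \<le> N" "N < (4 * y\<^sup>2 + 1) ^ Suc k"
    and rich: "2 ^ k \<le> card (circle_points (int n))"
    by (rule exists_rich_circle[OF N y])
  define K where "K = card (circle_points (int n))"
  define M where "M = floor_sqrt N"
  have M2: "M\<^sup>2 \<le> N" by (simp add: M_def)
  have M0: "M > 0" using N by (simp add: M_def)
  have K0: "K > 0" using rich by (auto simp: K_def intro: gr0I)
  have "(2 ^ k)\<^sup>2 = (4 :: nat) ^ k" by (metis power_mult mult.commute power2_eq_square mult_2_right numeral_Bit0)
  also have "\<dots> \<le> (4 * y\<^sup>2 + 1) ^ k"
  proof (rule power_mono)
    have "1 \<le> y\<^sup>2" using y by (simp add: Suc_le_eq)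
    then show "4 \<le> 4 * y\<^sup>2 + 1" by linarith
  qed simp
  also have "\<dots> \<le> N" by (rule k)
  also have "\<dots> < (Suc M)\<^sup>2" by (simp add: M_def Suc_floor_sqrt_power2_gt)
  finally have "2 ^ k < Suc M" by (rule power_less_imp_less_base) simp
  then have kM: "2 ^ k \<le> M" by simp
  have "(K * M) * (2 ^ k * card A) = 2 ^ k * (K * (M * card A))" by (simp add: mult_ac)
  also have "\<dots> \<le> 2 ^ k * ((3 * N)\<^sup>2 * (K + 2 * M))"
    unfolding K_def by (intro mult_left_mono isosceles_free_card_le A n M2) simp
  also have "\<dots> = (3 * N)\<^sup>2 * (2 ^ k * K + 2 * (2 ^ k * M))" by (simp add: algebra_simps)
  also have "\<dots> \<le> (3 * N)\<^sup>2 * (M * K + 2 * (K * M))"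
    using kM rich by (intro mult_left_mono add_mono mult_right_mono) (auto simp: K_def)
  also have "\<dots> = (K * M) * (27 * N\<^sup>2)" by (simp add: power2_eq_square algebra_simps)
  finally have "2 ^ k * card A \<le> 27 * N\<^sup>2" using K0 M0 by simp
  moreover have "2 ^ Suc k * card A = 2 * (2 ^ k * card A)" by simp
  ultimately have "2 ^ Suc k * card A \<le> 54 * N\<^sup>2" by linarith
  with k(2) show ?thesis by (rule that)
qed

theorem theorem1p4:
  shows "\<exists>c>0. \<exists>C>0. \<forall>N::nat. N \<ge> 3 \<longrightarrow>
    real (max_isosceles_free N)
      \<le> C * ((real N)\<^sup>2 * exp (- c * (ln (real N) / ln (ln (real N)))))"
proof -
  define l where "l = ln (ln (3 :: real))"
  have l: "l > 0" using ln3_gt_1 by (simp add: l_def)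
  \<comment> \<open>\<open>ln ln N\<close> may be less than \<open>1\<close>, but it is at least \<open>l > 0\<close>; so \<open>D\<close> absorbs the constant \<open>ln 37\<close> in\<close>
  \<comment> \<open>\<open>ln (4 y\<^sup>2 + 1) \<le> ln 37 + 2 ln ln N\<close>\<close>
  define D where "D = 2 + ln 37 / l"
  have D: "D > 0" using l by (simp add: D_def add_pos_nonneg)
  have "real (max_isosceles_free N) \<le> 54 * ((real N)\<^sup>2 * exp (- (ln 2 / D) * (ln (real N) / ln (ln (real N)))))"
    if N: "N \<ge> 3" for N
  proof -
    define L where "L = ln (real N)"
    have L3: "L \<ge> ln 3" using N by (simp add: L_def)
    have L1: "L > 1" using L3 ln3_gt_1 by linarith
    have lL: "l \<le> ln L" using L3 ln3_gt_1 by (simp add: l_def)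
    obtain e where e: "2 ^ e \<le> N" "N < 2 ^ Suc e"
      using ex_power_ivl1[of 2 N] N by auto
    \<comment> \<open>the least exponent with \<open>N < 2 ^ y\<close>, so that \<open>y\<close> is of the order of \<open>L\<close>\<close>
    define y where "y = Suc e"
    define Q where "Q = 4 * (real y)\<^sup>2 + 1"
    have "real e * ln 2 = ln (2 ^ e)" by (simp add: ln_realpow)
    also have "\<dots> \<le> L" unfolding L_def using e(1) N by (subst ln_le_cancel_iff) (auto simp flip: of_nat_le_iff)
    finally have "real e * (1 / 2) \<le> L"
      using ln2_ge_two_thirds by (intro order.trans[OF mult_left_mono, of "1/2" "ln 2"]) auto
    then have "real y \<le> 3 * L" using L1 by (simp add: y_def)
    then have "(real y)\<^sup>2 \<le> (3 * L)\<^sup>2" by (intro power_mono) auto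
    moreover have "1 \<le> L\<^sup>2" using L1 by simp
    ultimately have "Q \<le> 37 * L\<^sup>2" by (simp add: Q_def power_mult_distrib)
    then have "ln Q \<le> ln (37 * L\<^sup>2)" using L1 by (subst ln_le_cancel_iff) (auto simp: Q_def add_nonneg_pos)
    also have "\<dots> = ln 37 + 2 * ln L" using L1 by (simp add: ln_mult ln_realpow)
    also have "\<dots> \<le> D * ln L"
    proof -
      have "ln 37 / l * l \<le> ln 37 / l * ln L" using l lL by (intro mult_left_mono) auto
      then show ?thesis using l by (simp add: D_def algebra_simps)
    qed
    finally have lnQ: "ln Q \<le> D * ln L" .
    have "max_isosceles_free N \<in> {card A | A. A \<subseteq> grid N \<and> isosceles_free A}"
      unfolding max_isosceles_free_def by (intro Max_in max_isosceles_free_wf)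
    then obtain A where A: "A \<subseteq> grid N" "isosceles_free A" "max_isosceles_free N = card A" by auto
    obtain k where k: "N < (4 * y\<^sup>2 + 1) ^ Suc k" "2 ^ Suc k * card A \<le> 54 * N\<^sup>2"
      by (rule isosceles_free_card_mult_power_le[OF A(1,2), of y]) (use N e(2) y_def in auto)
    have "real N \<le> Q ^ Suc k"
    proof -
      have "real N \<le> real ((4 * y\<^sup>2 + 1) ^ Suc k)" using k(1) by (simp only: of_nat_le_iff less_imp_le)
      also have "\<dots> = Q ^ Suc k"
        unfolding of_nat_power by (simp add: Q_def add.commute del: power_Suc)
      finally show ?thesis .
    qed
    then have "L \<le> ln (Q ^ Suc k)" unfolding L_def using N by (subst ln_le_cancel_iff) (auto simp: Q_def add_nonneg_pos)
    also have "\<dots> = real (Suc k) * ln Q" by (rule ln_realpow)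
    also have "\<dots> \<le> real (Suc k) * (D * ln L)" using lnQ by (intro mult_left_mono) auto
    finally have "L / ln L / D \<le> real (Suc k)" using D l lL by (simp add: divide_simps mult_ac)
    then have "exp (ln 2 * (L / ln L / D)) \<le> exp (ln 2 * real (Suc k))"
      unfolding exp_le_cancel_iff by (rule mult_left_mono) simp
    also have "\<dots> = 2 ^ Suc k" by (simp only: exp_of_nat2_mult exp_ln zero_less_numeral)
    finally have pow: "exp (ln 2 / D * (L / ln L)) \<le> 2 ^ Suc k" by (simp add: mult_ac)
    have "exp (ln 2 / D * (L / ln L)) * real (card A) \<le> 2 ^ Suc k * real (card A)"
      using pow by (rule mult_right_mono) simp
    also have "\<dots> = real (2 ^ Suc k * card A)" by simp
    also have "\<dots> \<le> real (54 * N\<^sup>2)" using k(2) by (simp only: of_nat_le_iff)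
    finally have "card A \<le> 54 * (real N)\<^sup>2 / exp (ln 2 / D * (L / ln L))" by (simp add: field_simps)
    also have "\<dots> = 54 * ((real N)\<^sup>2 * exp (- (ln 2 / D * (L / ln L))))" by (simp add: exp_minus divide_inverse)
    finally show ?thesis by (simp add: A(3) L_def)
  qed
  moreover have "ln 2 / D > 0" using D by simp
  ultimately show ?thesis by (intro exI[of _ "ln 2 / D"] exI[of _ 54] conjI) auto
qed

end
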